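(* The presheaf 2-monad $\mathbb{P}=(\mathsf{P},\mathsf{s},\mathsf{y})$ on $\mathcal{Q}\text{-}\mathbf{Cat}$ distributes flatly over itself by $\lambda$ with $$\lambda_X=\mathsf{y}_{\mathsf{P}X}\cdot{\sup}_{\mathsf{P}X}:\mathsf{P}\mathsf{P}X\to\mathsf{P}\mathsf{P}X ;$$ that is, the family $(\lambda_X)_X$, $X$ ranging over all $\mathcal{Q}$-categories, is a flat distributive law of the 2-monad $\mathbb{P}$ over $\mathbb{P}$.
   Context: Basic conventions. $\mathcal{Q}$ is a small quantaloid: a small category whose hom-sets are complete lattices (order $\preceq$) and whose composition preserves arbitrary suprema in each variable; $\mathcal{Q}_0$ is its object set. For $u:r\to s$, $v:s\to t$, $w:r\to t$ in $\mathcal{Q}$, the arrows $v\searrow w:r\to s$ and $w\swarrow u:s\to t$ are defined by $u\preceq v\searrow w\iff v\circ u\preceq w\iff v\preceq w\swarrow u$. For sets $X,Y$ equipped with type maps $|\text{-}|$ to $\mathcal{Q}_0$, a $\mathcal{Q}$-relation $\phi:X\nrightarrow Y$ assigns to each $(x,y)$ a morphism $\phi(x,y):|x|\to|y|$ of $\mathcal{Q}$; these are ordered pointwise by $\preceq$ and composed by $(\psi\circ\phi)(x,z)=\bigvee_y\psi(y,z)\circ\phi(x,y)$. A $\mathcal{Q}$-category is a set $X$ over $\mathcal{Q}_0$ with a $\mathcal{Q}$-relation $1_X^*:X\nrightarrow X$ (its hom) such that $1_{|x|}\preceq 1_X^*(x,x)$ and $1_X^*\circ 1_X^*\preceq 1_X^*$;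 it is preordered by $x\leq x'\iff |x|=|x'|$ and $1_{|x|}\preceq 1_X^*(x,x')$. A $\mathcal{Q}$-functor $f:X\to Y$ is a type-preserving map with $1_X^*(x,x')\preceq 1_Y^*(fx,fx')$; $f\leq g$ is pointwise. This gives the locally preordered 2-category $\mathcal{Q}\text{-}\mathbf{Cat}$. A 2-functor on it is a functor that is monotone on homs; a 2-monad $(T,m,e)$ is a monad whose functor $T$ is a 2-functor (multiplication $m:TT\to T$, unit $e:1\to T$). A distributor $\phi:X\nrightarrow Y$ is a $\mathcal{Q}$-relation with $1_Y^*\circ\phi\circ 1_X^*\preceq\phi$; distributors form the quantaloid $\mathcal{Q}\text{-}\mathbf{Dist}$, with identities $1_X^*$. For a $\mathcal{Q}$-functor $f:X\to Y$: $f_*:X\nrightarrow Y$, $f_*(x,y)=1_Y^*(fx,y)$, and $f^*:Y\nrightarrow X$, $f^*(y,x)=1_Y^*(y,fx)$. $\mathsf{P}X$ is the $\mathcal{Q}$-category of distributors $\sigma:X\nrightarrow\{s\}$ ($s\in\mathcal{Q}_0$, $|\sigma|=s$, $\{s\}$ the one-object $\mathcal{Q}$-category of type $s$ with hom $1_s$) with $1_{\mathsf{P}X}^*(\sigma,\sigma')=\bigwedge_x\sigma'(x)\swarrow\sigma(x)$. The Yoneda embedding is $\mathsf{y}_X:X\to\mathsf{P}X$, $x\mapsto 1_X^*(-,x)$. For $f:X\to Y$: $f_!:\mathsf{P}X\to\mathsf{P}Y$, $\sigma\mapsto\sigma\circ f^*$, and $f^!:\mathsf{P}Y\to\mathsf{P}X$,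 $\sigma\mapsto\sigma\circ f_*$. The presheaf 2-monad $\mathbb{P}=(\mathsf{P},\mathsf{s},\mathsf{y})$ sends $f$ to $f_!$, has unit $\mathsf{y}$ and multiplication $\mathsf{s}_X=\sup_{\mathsf{P}X}=\mathsf{y}_X^!:\mathsf{P}\mathsf{P}X\to\mathsf{P}X$, where $\sup_{\mathsf{P}X}$ is the left adjoint of $\mathsf{y}_{\mathsf{P}X}$. Distributive laws ("distributive law" means lax distributive law). For a 2-monad $\mathbb{T}=(T,m,e)$ on $\mathcal{Q}\text{-}\mathbf{Cat}$, a distributive law $\lambda:T\mathsf{P}\to\mathsf{P}T$ of $\mathbb{T}$ over $\mathbb{P}$ is a family of $\mathcal{Q}$-functors $\lambda_X:T\mathsf{P}X\to\mathsf{P}TX$ such that for all $\mathcal{Q}$-functors $f:X\to Y$: (a) $(Tf)_!\cdot\lambda_X\leq\lambda_Y\cdot T(f_!)$; (b) $\mathsf{y}_{TX}\leq\lambda_X\cdot T\mathsf{y}_X$; (c) $\mathsf{s}_{TX}\cdot(\lambda_X)_!\cdot\lambda_{\mathsf{P}X}\leq\lambda_X\cdot T\mathsf{s}_X$; (d) $(e_X)_!\leq\lambda_X\cdot e_{\mathsf{P}X}$; (e) $(m_X)_!\cdot\lambda_{TX}\cdot T\lambda_X\leq\lambda_X\cdot m_{\mathsf{P}X}$. It is flat if (b) is an equality for all $X$. "$\mathbb{T}$ distributes flatly over $\mathbb{P}$ by $\lambda$" means that $\lambda$ is a flat distributive law of $\mathbb{T}$ over $\mathbb{P}$. *)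

theory Defs
  imports "HOL-Algebra.Complete_Lattice" "HOL-Library.FuncSet"
begin

section \<open>Small quantaloids\<close>

text \<open>\<open>qcomp Q v u\<close> is the composite "\<open>v\<close> after \<open>u\<close>".  Every arrow has one domain and one
  codomain, so the hom-sets are disjoint and a single relation \<open>qleq Q\<close> carries the
  orders of all hom-sets; arrows that are not parallel are never compared.\<close>

record ('o, 'm) quantaloid_data =
  Obj :: "'o set"
  Arr :: "'m set"
  qdom :: "'m \<Rightarrow> 'o"
  qcod :: "'m \<Rightarrow> 'o"
  qid :: "'o \<Rightarrow> 'm"
  qcomp :: "'m \<Rightarrow> 'm \<Rightarrow> 'm"
  qleq :: "'m \<Rightarrow> 'm \<Rightarrow> bool"

definition Hom :: "('o, 'm) quantaloid_data \<Rightarrow> 'o \<Rightarrow> 'o \<Rightarrow> 'm gorder" where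
  "Hom Q r s =
     \<lparr>carrier = {u \<in> Arr Q. qdom Q u = r \<and> qcod Q u = s}, eq = (=), le = qleq Q\<rparr>"

locale quantaloid =
  fixes Q :: "('o, 'm) quantaloid_data"
  assumes dom_Obj: "u \<in> Arr Q \<Longrightarrow> qdom Q u \<in> Obj Q"
    and cod_Obj: "u \<in> Arr Q \<Longrightarrow> qcod Q u \<in> Obj Q"
    and id_Hom: "r \<in> Obj Q \<Longrightarrow> qid Q r \<in> carrier (Hom Q r r)"
    and comp_Hom: "\<lbrakk>u \<in> carrier (Hom Q r s); v \<in> carrier (Hom Q s t)\<rbrakk>
      \<Longrightarrow> qcomp Q v u \<in> carrier (Hom Q r t)"
    and comp_id_right: "u \<in> carrier (Hom Q r s) \<Longrightarrow> qcomp Q u (qid Q r) = u"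
    and comp_id_left: "u \<in> carrier (Hom Q r s) \<Longrightarrow> qcomp Q (qid Q s) u = u"
    and comp_assoc: "\<lbrakk>u \<in> carrier (Hom Q r s); v \<in> carrier (Hom Q s t); w \<in> carrier (Hom Q t p)\<rbrakk>
      \<Longrightarrow> qcomp Q (qcomp Q w v) u = qcomp Q w (qcomp Q v u)"
    and Hom_complete_lattice: "\<lbrakk>r \<in> Obj Q; s \<in> Obj Q\<rbrakk> \<Longrightarrow> complete_lattice (Hom Q r s)"
    and comp_Sup_right: "\<lbrakk>r \<in> Obj Q; v \<in> carrier (Hom Q s t); U \<subseteq> carrier (Hom Q r s)\<rbrakk>
      \<Longrightarrow> qcomp Q v (\<Squnion>\<^bsub>Hom Q r s\<^esub> U) = \<Squnion>\<^bsub>Hom Q r t\<^esub> (qcomp Q v ` U)"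
    and comp_Sup_left: "\<lbrakk>t \<in> Obj Q; u \<in> carrier (Hom Q r s); V \<subseteq> carrier (Hom Q s t)\<rbrakk>
      \<Longrightarrow> qcomp Q (\<Squnion>\<^bsub>Hom Q s t\<^esub> V) u = \<Squnion>\<^bsub>Hom Q r t\<^esub> ((\<lambda>v. qcomp Q v u) ` V)"

text \<open>\<open>residual Q w u\<close> is \<open>w \<swarrow> u : s \<rightarrow> t\<close>, for \<open>u : r \<rightarrow> s\<close> and \<open>w : r \<rightarrow> t\<close>.\<close>

definition residual :: "('o, 'm) quantaloid_data \<Rightarrow> 'm \<Rightarrow> 'm \<Rightarrow> 'm" where
  "residual Q w u =
     (THE l. l \<in> carrier (Hom Q (qcod Q u) (qcod Q w)) \<and>
        (\<forall>v \<in> carrier (Hom Q (qcod Q u) (qcod Q w)). qleq Q (qcomp Q v u) w \<longleftrightarrow> qleq Q v l))"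

section \<open>Categories, functors and distributors over a quantaloid\<close>

record ('a, 'o, 'm) qcat =
  elts :: "'a set"
  obj_of :: "'a \<Rightarrow> 'o"
  qhom :: "'a \<Rightarrow> 'a \<Rightarrow> 'm"

definition qrel :: "('o, 'm) quantaloid_data \<Rightarrow> ('a, 'o, 'm) qcat \<Rightarrow> ('b, 'o, 'm) qcat
    \<Rightarrow> ('a \<Rightarrow> 'b \<Rightarrow> 'm) \<Rightarrow> bool" where
  "qrel Q X Y \<phi> \<longleftrightarrow> (\<forall>x \<in> elts X. \<forall>y \<in> elts Y. \<phi> x y \<in> carrier (Hom Q (obj_of X x) (obj_of Y y)))"

definition qrel_le :: "('o, 'm) quantaloid_data \<Rightarrow> ('a, 'o, 'm) qcat \<Rightarrow> ('b, 'o, 'm) qcat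
    \<Rightarrow> ('a \<Rightarrow> 'b \<Rightarrow> 'm) \<Rightarrow> ('a \<Rightarrow> 'b \<Rightarrow> 'm) \<Rightarrow> bool" where
  "qrel_le Q X Y \<phi> \<psi> \<longleftrightarrow> (\<forall>x \<in> elts X. \<forall>y \<in> elts Y. qleq Q (\<phi> x y) (\<psi> x y))"

definition qrel_comp :: "('o, 'm) quantaloid_data \<Rightarrow> ('a, 'o, 'm) qcat \<Rightarrow> ('b, 'o, 'm) qcat
    \<Rightarrow> ('c, 'o, 'm) qcat \<Rightarrow> ('b \<Rightarrow> 'c \<Rightarrow> 'm) \<Rightarrow> ('a \<Rightarrow> 'b \<Rightarrow> 'm) \<Rightarrow> 'a \<Rightarrow> 'c \<Rightarrow> 'm" where
  "qrel_comp Q X Y Z \<psi> \<phi> =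
     (\<lambda>x z. \<Squnion>\<^bsub>Hom Q (obj_of X x) (obj_of Z z)\<^esub> ((\<lambda>y. qcomp Q (\<psi> y z) (\<phi> x y)) ` elts Y))"

definition qcategory :: "('o, 'm) quantaloid_data \<Rightarrow> ('a, 'o, 'm) qcat \<Rightarrow> bool" where
  "qcategory Q X \<longleftrightarrow>
     obj_of X ` elts X \<subseteq> Obj Q \<and>
     qrel Q X X (qhom X) \<and>
     (\<forall>x \<in> elts X. qleq Q (qid Q (obj_of X x)) (qhom X x x)) \<and>
     qrel_le Q X X (qrel_comp Q X X X (qhom X) (qhom X)) (qhom X)"

definition elt_le :: "('o, 'm) quantaloid_data \<Rightarrow> ('a, 'o, 'm) qcat \<Rightarrow> 'a \<Rightarrow> 'a \<Rightarrow> bool" where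
  "elt_le Q X x x' \<longleftrightarrow> obj_of X x = obj_of X x' \<and> qleq Q (qid Q (obj_of X x)) (qhom X x x')"

definition qfunctor :: "('o, 'm) quantaloid_data \<Rightarrow> ('a, 'o, 'm) qcat \<Rightarrow> ('b, 'o, 'm) qcat
    \<Rightarrow> ('a \<Rightarrow> 'b) \<Rightarrow> bool" where
  "qfunctor Q X Y f \<longleftrightarrow>
     f ` elts X \<subseteq> elts Y \<and>
     (\<forall>x \<in> elts X. obj_of Y (f x) = obj_of X x) \<and>
     (\<forall>x \<in> elts X. \<forall>x' \<in> elts X. qleq Q (qhom X x x') (qhom Y (f x) (f x')))"

definition qfun_le :: "('o, 'm) quantaloid_data \<Rightarrow> ('a, 'o, 'm) qcat \<Rightarrow> ('b, 'o, 'm) qcat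
    \<Rightarrow> ('a \<Rightarrow> 'b) \<Rightarrow> ('a \<Rightarrow> 'b) \<Rightarrow> bool" where
  "qfun_le Q X Y f g \<longleftrightarrow> (\<forall>x \<in> elts X. elt_le Q Y (f x) (g x))"

definition left_adjoint :: "('o, 'm) quantaloid_data \<Rightarrow> ('a, 'o, 'm) qcat \<Rightarrow> ('b, 'o, 'm) qcat
    \<Rightarrow> ('a \<Rightarrow> 'b) \<Rightarrow> ('b \<Rightarrow> 'a) \<Rightarrow> bool" where
  "left_adjoint Q X Y f g \<longleftrightarrow>
     qfunctor Q X Y f \<and> qfunctor Q Y X g \<and>
     qfun_le Q X X id (g \<circ> f) \<and> qfun_le Q Y Y (f \<circ> g) id"

definition distributor :: "('o, 'm) quantaloid_data \<Rightarrow> ('a, 'o, 'm) qcat \<Rightarrow> ('b, 'o, 'm) qcat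
    \<Rightarrow> ('a \<Rightarrow> 'b \<Rightarrow> 'm) \<Rightarrow> bool" where
  "distributor Q X Y \<phi> \<longleftrightarrow>
     qrel Q X Y \<phi> \<and>
     qrel_le Q X Y (qrel_comp Q X Y Y (qhom Y) (qrel_comp Q X X Y \<phi> (qhom X))) \<phi>"

definition lower_star :: "('b, 'o, 'm) qcat \<Rightarrow> ('a \<Rightarrow> 'b) \<Rightarrow> 'a \<Rightarrow> 'b \<Rightarrow> 'm" where
  "lower_star Y f = (\<lambda>x y. qhom Y (f x) y)"

definition upper_star :: "('b, 'o, 'm) qcat \<Rightarrow> ('a \<Rightarrow> 'b) \<Rightarrow> 'b \<Rightarrow> 'a \<Rightarrow> 'm" where
  "upper_star Y f = (\<lambda>y x. qhom Y y (f x))"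

section \<open>The presheaf 2-monad\<close>

definition point :: "('o, 'm) quantaloid_data \<Rightarrow> 'o \<Rightarrow> (unit, 'o, 'm) qcat" where
  "point Q s = \<lparr>elts = {()}, obj_of = (\<lambda>_. s), qhom = (\<lambda>_ _. qid Q s)\<rparr>"

text \<open>A presheaf \<open>\<sigma> : X \<rightharpoonup> {s}\<close> is the pair of its type \<open>s\<close> and the function
  \<open>x \<mapsto> \<sigma>(x)\<close>.  The function is extensional on \<open>elts X\<close>, so that equality of pairs
  is equality of presheaves; the type is recorded because the function does not
  determine it when \<open>X\<close> is empty.\<close>

type_synonym ('a, 'o, 'm) presheaf = "'o \<times> ('a \<Rightarrow> 'm)"

definition PSh :: "('o, 'm) quantaloid_data \<Rightarrow> ('a, 'o, 'm) qcat
    \<Rightarrow> (('a, 'o, 'm) presheaf, 'o, 'm) qcat" where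
  "PSh Q X =
     \<lparr>elts = {(s, \<sigma>). s \<in> Obj Q \<and> \<sigma> \<in> extensional (elts X) \<and>
                distributor Q X (point Q s) (\<lambda>x _. \<sigma> x)},
      obj_of = fst,
      qhom = (\<lambda>\<sigma> \<sigma>'. \<Sqinter>\<^bsub>Hom Q (fst \<sigma>) (fst \<sigma>')\<^esub>
                ((\<lambda>x. residual Q (snd \<sigma>' x) (snd \<sigma> x)) ` elts X))\<rparr>"

definition yoneda :: "('a, 'o, 'm) qcat \<Rightarrow> 'a \<Rightarrow> ('a, 'o, 'm) presheaf" where
  "yoneda X x = (obj_of X x, restrict (\<lambda>x'. qhom X x' x) (elts X))"

text \<open>\<open>push Q X Y f\<close> is \<open>f\<^sub>!\<close> and \<open>pull Q X Y f\<close> is \<open>f\<^sup>!\<close>, for \<open>f : X \<rightarrow> Y\<close>.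
  The former is also the action of the presheaf 2-monad on \<open>f\<close>.\<close>

definition push :: "('o, 'm) quantaloid_data \<Rightarrow> ('a, 'o, 'm) qcat \<Rightarrow> ('b, 'o, 'm) qcat
    \<Rightarrow> ('a \<Rightarrow> 'b) \<Rightarrow> ('a, 'o, 'm) presheaf \<Rightarrow> ('b, 'o, 'm) presheaf" where
  "push Q X Y f \<sigma> =
     (fst \<sigma>, restrict
        (\<lambda>y. qrel_comp Q Y X (point Q (fst \<sigma>)) (\<lambda>x _. snd \<sigma> x) (upper_star Y f) y ())
        (elts Y))"

definition pull :: "('o, 'm) quantaloid_data \<Rightarrow> ('a, 'o, 'm) qcat \<Rightarrow> ('b, 'o, 'm) qcat
    \<Rightarrow> ('a \<Rightarrow> 'b) \<Rightarrow> ('b, 'o, 'm) presheaf \<Rightarrow> ('a, 'o, 'm) presheaf" where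
  "pull Q X Y f \<sigma> =
     (fst \<sigma>, restrict
        (\<lambda>x. qrel_comp Q X Y (point Q (fst \<sigma>)) (\<lambda>y _. snd \<sigma> y) (lower_star Y f) x ())
        (elts X))"

definition mult :: "('o, 'm) quantaloid_data \<Rightarrow> ('a, 'o, 'm) qcat
    \<Rightarrow> (('a, 'o, 'm) presheaf, 'o, 'm) presheaf \<Rightarrow> ('a, 'o, 'm) presheaf" where
  "mult Q X = pull Q X (PSh Q X) (yoneda X)"

text \<open>\<open>sup_map Q A\<close> is the left adjoint of the Yoneda embedding of \<open>A\<close>.  It is determined
  on \<open>elts (PSh Q A)\<close> when it exists and \<open>A\<close> is separated, in particular for
  \<open>A = PSh Q X\<close>.\<close>

definition sup_map :: "('o, 'm) quantaloid_data \<Rightarrow> ('a, 'o, 'm) qcat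
    \<Rightarrow> ('a, 'o, 'm) presheaf \<Rightarrow> 'a" where
  "sup_map Q A = (SOME g. left_adjoint Q (PSh Q A) A g (yoneda A))"

text \<open>HOL has no variables for type constructors, so a distributive law of an arbitrary 2-monad
  \<open>T\<close> cannot be a predicate on a whole family \<open>\<lambda>\<close>.  A particular family is a polymorphic
  constant such as the one below, and the axioms of a distributive law are stated for it with
  \<open>T\<close> instantiated to \<open>PSh Q\<close>, acting on functors by \<open>push Q\<close>.\<close>

definition yoneda_sup_law :: "('o, 'm) quantaloid_data \<Rightarrow> ('a, 'o, 'm) qcat
    \<Rightarrow> (('a, 'o, 'm) presheaf, 'o, 'm) presheaf
    \<Rightarrow> (('a, 'o, 'm) presheaf, 'o, 'm) presheaf" where
  "yoneda_sup_law Q X = yoneda (PSh Q X) \<circ> sup_map Q (PSh Q X)"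

end

theory Submission
  imports Defs
begin

text \<open>The proof treats presheaves as a Kleisli triple.  For a functor \<open>g : A \<rightarrow> \<P>X\<close> let
  \<open>colim g : \<P>A \<rightarrow> \<P>X\<close> send \<open>\<sigma>\<close> to \<open>x \<mapsto> \<Or>\<^sub>a \<sigma>(a) \<circ> g(a)(x)\<close>, the colimit of \<open>g\<close> weighted
  by \<open>\<sigma>\<close>.  With \<open>y\<close> the Yoneda embedding, three laws hold:
  \<open>colim y = 1\<close> (\<open>colim_of_yoneda\<close>), \<open>colim g \<cdot> y = g\<close> (\<open>colim_yoneda\<close>) and
  \<open>colim g \<cdot> colim k = colim (colim g \<cdot> k)\<close> (\<open>colim_colim\<close>).  The structure of the presheaf monad
  is recovered as \<open>f\<^sub>! = colim (y \<cdot> f)\<close> and, by the Yoneda lemma, \<open>s = colim 1\<close>; hence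
  \<open>s \<cdot> g\<^sub>! = colim g\<close> (\<open>mult_push\<close>) and \<open>f\<^sub>! \<cdot> y = y \<cdot> f\<close> (\<open>push_yoneda\<close>).

  The multiplication \<open>s\<close> is left adjoint to \<open>y\<close>, and presheaf categories are separated, so the
  abstractly chosen supremum agrees with \<open>s\<close> on presheaves and the law is \<open>\<lambda> = y \<cdot> s\<close>.  Every
  axiom then becomes a short calculation, with indices suppressed:

  \<^item> \<open>f\<^sub>!\<^sub>! \<cdot> \<lambda> = y \<cdot> f\<^sub>! \<cdot> s = y \<cdot> s \<cdot> f\<^sub>!\<^sub>! = \<lambda> \<cdot> f\<^sub>!\<^sub>!\<close>, since \<open>f\<^sub>! \<cdot> s\<close> and \<open>s \<cdot> f\<^sub>!\<^sub>!\<close> are both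
    \<open>colim f\<^sub>!\<close>;
  \<^item> \<open>\<lambda> \<cdot> y\<^sub>! = y \<cdot> s \<cdot> y\<^sub>! = y\<close>, which is flatness;
  \<^item> \<open>s \<cdot> \<lambda>\<^sub>! \<cdot> \<lambda> = s \<cdot> \<lambda>\<^sub>! \<cdot> y \<cdot> s = s \<cdot> y \<cdot> \<lambda> \<cdot> s = \<lambda> \<cdot> s = y \<cdot> s \<cdot> s = y \<cdot> s \<cdot> s\<^sub>! = \<lambda> \<cdot> s\<^sub>!\<close>;
  \<^item> \<open>y\<^sub>! \<le> y \<cdot> s \<cdot> y\<^sub>! = y = \<lambda> \<cdot> y\<close>, by the unit of the adjunction between \<open>s\<close> and \<open>y\<close>;
  \<^item> \<open>s\<^sub>! \<cdot> \<lambda> \<cdot> \<lambda>\<^sub>! = s\<^sub>! \<cdot> y \<cdot> s \<cdot> \<lambda>\<^sub>! = y \<cdot> s \<cdot> s \<cdot> \<lambda>\<^sub>! = y \<cdot> s \<cdot> s\<^sub>! = y \<cdot> s \<cdot> s = \<lambda> \<cdot> s\<close>, where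
    \<open>s \<cdot> \<lambda>\<^sub>! = colim (y \<cdot> s) = s\<^sub>!\<close>.

  The unit of the adjunction is thus the only step in these calculations that may fail to be an
  equality.\<close>

section \<open>Calculus in a quantaloid\<close>

context quantaloid
begin

abbreviation arrows :: "'o \<Rightarrow> 'o \<Rightarrow> 'm set" where
  "arrows r s \<equiv> carrier (Hom Q r s)"

abbreviation composite :: "'m \<Rightarrow> 'm \<Rightarrow> 'm" (infixr "\<odot>" 75) where
  "v \<odot> u \<equiv> qcomp Q v u"

abbreviation below :: "'m \<Rightarrow> 'm \<Rightarrow> bool" (infix "\<preceq>" 50) where
  "u \<preceq> v \<equiv> qleq Q u v"

lemma arrows_dom: "u \<in> arrows r s \<Longrightarrow> r \<in> Obj Q"
  and arrows_cod: "u \<in> arrows r s \<Longrightarrow> s \<in> Obj Q"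
  using dom_Obj cod_Obj by (auto simp: Hom_def)

lemma arrows_qcod: "u \<in> arrows r s \<Longrightarrow> qcod Q u = s"
  by (auto simp: Hom_def)

lemma le_Hom [simp]: "le (Hom Q r s) = qleq Q"
  by (simp add: Hom_def)

lemma eq_Hom [simp]: "eq (Hom Q r s) = (=)"
  by (simp add: Hom_def)

lemma below_refl: "u \<in> arrows r s \<Longrightarrow> u \<preceq> u"
proof -
  assume u: "u \<in> arrows r s"
  interpret complete_lattice "Hom Q r s"
    using Hom_complete_lattice[OF arrows_dom[OF u] arrows_cod[OF u]] .
  show ?thesis using le_refl[of u] u by simp
qed

lemma below_trans:
  assumes "u \<preceq> v" "v \<preceq> w" "u \<in> arrows r s" "v \<in> arrows r s" "w \<in> arrows r s"
  shows "u \<preceq> w"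
proof -
  interpret complete_lattice "Hom Q r s"
    using Hom_complete_lattice[OF arrows_dom[OF assms(3)] arrows_cod[OF assms(3)]] .
  show ?thesis using le_trans[of u v w] assms by simp
qed

lemma below_antisym:
  assumes "u \<preceq> v" "v \<preceq> u" "u \<in> arrows r s" "v \<in> arrows r s"
  shows "u = v"
proof -
  interpret complete_lattice "Hom Q r s"
    using Hom_complete_lattice[OF arrows_dom[OF assms(3)] arrows_cod[OF assms(3)]] .
  show ?thesis using le_antisym[of u v] assms by simp
qed

lemma Sup_arrows:
  assumes "r \<in> Obj Q" "s \<in> Obj Q" "U \<subseteq> arrows r s"
  shows "\<Squnion>\<^bsub>Hom Q r s\<^esub> U \<in> arrows r s"
proof -
  interpret complete_lattice "Hom Q r s"
    using Hom_complete_lattice assms by blast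
  show ?thesis using sup_closed assms by blast
qed

lemma Sup_below_iff:
  assumes "r \<in> Obj Q" "s \<in> Obj Q" "U \<subseteq> arrows r s" "w \<in> arrows r s"
  shows "\<Squnion>\<^bsub>Hom Q r s\<^esub> U \<preceq> w \<longleftrightarrow> (\<forall>u \<in> U. u \<preceq> w)"
proof -
  interpret complete_lattice "Hom Q r s"
    using Hom_complete_lattice assms by blast
  have "u \<preceq> \<Squnion>\<^bsub>Hom Q r s\<^esub> U" if "u \<in> U" for u
    using sup_upper[of U u] that assms by auto
  moreover have "\<Squnion>\<^bsub>Hom Q r s\<^esub> U \<preceq> w" if "\<forall>u \<in> U. u \<preceq> w"
    using sup_least[of U w] that assms by (auto simp: Upper_def)
  ultimately show ?thesis
    using below_trans Sup_arrows[OF assms(1-3)] assms by blast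
qed

lemma below_Sup:
  assumes "U \<subseteq> arrows r s" "u \<in> U"
  shows "u \<preceq> \<Squnion>\<^bsub>Hom Q r s\<^esub> U"
proof -
  have "r \<in> Obj Q" "s \<in> Obj Q"
    using assms arrows_dom arrows_cod by blast+
  then show ?thesis
    using Sup_below_iff[OF _ _ assms(1) Sup_arrows] below_refl[OF Sup_arrows] assms by blast
qed

lemma Inf_arrows:
  assumes "r \<in> Obj Q" "s \<in> Obj Q" "U \<subseteq> arrows r s"
  shows "\<Sqinter>\<^bsub>Hom Q r s\<^esub> U \<in> arrows r s"
proof -
  interpret complete_lattice "Hom Q r s"
    using Hom_complete_lattice assms by blast
  show ?thesis using inf_closed assms by blast
qed

lemma below_Inf_iff:
  assumes "r \<in> Obj Q" "s \<in> Obj Q" "U \<subseteq> arrows r s" "w \<in> arrows r s"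
  shows "w \<preceq> \<Sqinter>\<^bsub>Hom Q r s\<^esub> U \<longleftrightarrow> (\<forall>u \<in> U. w \<preceq> u)"
proof -
  interpret complete_lattice "Hom Q r s"
    using Hom_complete_lattice assms by blast
  have "\<Sqinter>\<^bsub>Hom Q r s\<^esub> U \<preceq> u" if "u \<in> U" for u
    using inf_lower[of U u] that assms by auto
  moreover have "w \<preceq> \<Sqinter>\<^bsub>Hom Q r s\<^esub> U" if "\<forall>u \<in> U. w \<preceq> u"
    using inf_greatest[of U w] that assms by (auto simp: Lower_def)
  ultimately show ?thesis
    using below_trans Inf_arrows[OF assms(1-3)] assms by blast
qed

text \<open>Monotonicity is preservation of the binary joins \<open>u \<or> u' = u'\<close> and \<open>v \<or> v' = v'\<close>.\<close>

lemma comp_mono: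
  assumes "v \<preceq> v'" "u \<preceq> u'"
    and "v \<in> arrows s t" "v' \<in> arrows s t" "u \<in> arrows r s" "u' \<in> arrows r s"
  shows "v \<odot> u \<preceq> v' \<odot> u'"
proof -
  have obj: "r \<in> Obj Q" "s \<in> Obj Q" "t \<in> Obj Q"
    using assms arrows_dom arrows_cod by blast+
  have "\<Squnion>\<^bsub>Hom Q r s\<^esub> {u, u'} = u'"
    using assms obj by (intro below_antisym[of _ _ r s])
      (auto simp: Sup_below_iff below_refl intro!: Sup_arrows below_Sup)
  then have "v \<odot> u' = \<Squnion>\<^bsub>Hom Q r t\<^esub> {v \<odot> u, v \<odot> u'}"
    using comp_Sup_right[of r v s t "{u, u'}"] assms obj by simp
  then have 1: "v \<odot> u \<preceq> v \<odot> u'"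
    using below_Sup[of "{v \<odot> u, v \<odot> u'}" r t "v \<odot> u"] comp_Hom assms by auto
  have "\<Squnion>\<^bsub>Hom Q s t\<^esub> {v, v'} = v'"
    using assms obj by (intro below_antisym[of _ _ s t])
      (auto simp: Sup_below_iff below_refl intro!: Sup_arrows below_Sup)
  then have "v' \<odot> u' = \<Squnion>\<^bsub>Hom Q r t\<^esub> {v \<odot> u', v' \<odot> u'}"
    using comp_Sup_left[of t u' r s "{v, v'}"] assms obj by simp
  then have "v \<odot> u' \<preceq> v' \<odot> u'"
    using below_Sup[of "{v \<odot> u', v' \<odot> u'}" r t "v \<odot> u'"] comp_Hom assms by auto
  then show ?thesis
    using assms by (intro below_trans[OF 1, of _ r t] comp_Hom[of _ r s _ t])
qed

lemma comp_Sup_below_iff: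
  assumes "v \<in> arrows s t" "r \<in> Obj Q" "U \<subseteq> arrows r s" "w \<in> arrows r t"
  shows "v \<odot> \<Squnion>\<^bsub>Hom Q r s\<^esub> U \<preceq> w \<longleftrightarrow> (\<forall>u \<in> U. v \<odot> u \<preceq> w)"
proof -
  have "t \<in> Obj Q"
    using assms arrows_cod by blast
  moreover have "qcomp Q v ` U \<subseteq> arrows r t"
    using assms by (auto intro!: comp_Hom)
  ultimately show ?thesis
    using comp_Sup_right assms by (simp add: Sup_below_iff)
qed

lemma Sup_comp_below_iff:
  assumes "u \<in> arrows r s" "t \<in> Obj Q" "V \<subseteq> arrows s t" "w \<in> arrows r t"
  shows "(\<Squnion>\<^bsub>Hom Q s t\<^esub> V) \<odot> u \<preceq> w \<longleftrightarrow> (\<forall>v \<in> V. v \<odot> u \<preceq> w)"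
proof -
  have "r \<in> Obj Q"
    using assms arrows_dom by blast
  moreover have "(\<lambda>v. v \<odot> u) ` V \<subseteq> arrows r t"
    using assms by (auto intro!: comp_Hom)
  ultimately show ?thesis
    using comp_Sup_left assms by (simp add: Sup_below_iff)
qed

text \<open>Joins are compared through their upper bounds: for these, exchanging iterated joins is
  exchanging quantifiers.\<close>

lemma arrow_eqI:
  assumes "u \<in> arrows r s" "v \<in> arrows r s"
    and "\<And>w. w \<in> arrows r s \<Longrightarrow> u \<preceq> w \<longleftrightarrow> v \<preceq> w"
  shows "u = v"
  using assms below_antisym below_refl by blast

text \<open>The residual is the join of all solutions \<open>v\<close> of \<open>v \<odot> u \<preceq> w\<close>; this join is
  itself a solution because composition with \<open>u\<close> preserves joins.\<close>

lemma residual: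
  assumes u: "u \<in> arrows r s" and w: "w \<in> arrows r t"
  shows residual_arrows: "residual Q w u \<in> arrows s t"
    and below_residual_iff: "v \<in> arrows s t \<Longrightarrow> v \<preceq> residual Q w u \<longleftrightarrow> v \<odot> u \<preceq> w"
proof -
  define P where "P = (\<lambda>l. l \<in> arrows s t \<and> (\<forall>v \<in> arrows s t. v \<odot> u \<preceq> w \<longleftrightarrow> v \<preceq> l))"
  define V where "V = {v \<in> arrows s t. v \<odot> u \<preceq> w}"
  define l where "l = \<Squnion>\<^bsub>Hom Q s t\<^esub> V"
  have obj: "s \<in> Obj Q" "t \<in> Obj Q"
    using arrows_cod u w by auto
  have V: "V \<subseteq> arrows s t" by (auto simp: V_def)
  have l: "l \<in> arrows s t"
    unfolding l_def using obj V by (rule Sup_arrows)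
  have "l \<odot> u \<preceq> w"
    unfolding l_def using Sup_comp_below_iff[OF u obj(2) V w] by (simp add: V_def)
  then have "v \<odot> u \<preceq> w" if "v \<in> arrows s t" "v \<preceq> l" for v
    using below_trans[of "v \<odot> u" "l \<odot> u" w r t] comp_mono[OF that(2) below_refl[OF u]]
      comp_Hom that u w l by blast
  moreover have "v \<preceq> l" if "v \<in> arrows s t" "v \<odot> u \<preceq> w" for v
    unfolding l_def using V that by (intro below_Sup) (auto simp: V_def)
  ultimately have "P l" using l by (auto simp: P_def)
  moreover have "l' = l" if "P l'" for l'
    using that \<open>P l\<close> below_refl below_antisym[of l' l s t] by (auto simp: P_def)
  ultimately have "P (THE l. P l)" by (rule theI)
  moreover have "residual Q w u = (THE l. P l)"
    unfolding residual_def P_def arrows_qcod[OF u] arrows_qcod[OF w] ..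
  ultimately have "P (residual Q w u)" by simp
  then show "residual Q w u \<in> arrows s t"
    and "v \<in> arrows s t \<Longrightarrow> v \<preceq> residual Q w u \<longleftrightarrow> v \<odot> u \<preceq> w"
    by (auto simp: P_def)
qed

end

section \<open>Categories and presheaves, element by element\<close>

context quantaloid
begin

lemma qcat_obj: "qcategory Q X \<Longrightarrow> x \<in> elts X \<Longrightarrow> obj_of X x \<in> Obj Q"
  by (auto simp: qcategory_def)

lemma qcat_hom:
  "qcategory Q X \<Longrightarrow> x \<in> elts X \<Longrightarrow> x' \<in> elts X \<Longrightarrow>
    qhom X x x' \<in> arrows (obj_of X x) (obj_of X x')"
  by (auto simp: qcategory_def qrel_def)

lemma qcat_id:
  "qcategory Q X \<Longrightarrow> x \<in> elts X \<Longrightarrow> qid Q (obj_of X x) \<preceq> qhom X x x"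
  by (auto simp: qcategory_def)

lemma qcat_comp:
  assumes X: "qcategory Q X" and x: "x \<in> elts X" "x' \<in> elts X" "x'' \<in> elts X"
  shows "qhom X x' x'' \<odot> qhom X x x' \<preceq> qhom X x x''"
proof -
  have "\<Squnion>\<^bsub>Hom Q (obj_of X x) (obj_of X x'')\<^esub> ((\<lambda>y. qhom X y x'' \<odot> qhom X x y) ` elts X)
      \<preceq> qhom X x x''"
    using X x by (auto simp: qcategory_def qrel_le_def qrel_comp_def)
  moreover have "(\<lambda>y. qhom X y x'' \<odot> qhom X x y) ` elts X
      \<subseteq> arrows (obj_of X x) (obj_of X x'')"
    using x by (auto intro!: comp_Hom[OF qcat_hom[OF X] qcat_hom[OF X]])
  ultimately show ?thesis
    using qcat_obj[OF X] qcat_hom[OF X] x by (simp add: Sup_below_iff)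
qed

lemma qcategoryI:
  assumes "\<And>x. x \<in> elts X \<Longrightarrow> obj_of X x \<in> Obj Q"
    and hom: "\<And>x x'. x \<in> elts X \<Longrightarrow> x' \<in> elts X \<Longrightarrow>
      qhom X x x' \<in> arrows (obj_of X x) (obj_of X x')"
    and "\<And>x. x \<in> elts X \<Longrightarrow> qid Q (obj_of X x) \<preceq> qhom X x x"
    and "\<And>x x' x''. x \<in> elts X \<Longrightarrow> x' \<in> elts X \<Longrightarrow> x'' \<in> elts X \<Longrightarrow>
      qhom X x' x'' \<odot> qhom X x x' \<preceq> qhom X x x''"
  shows "qcategory Q X"
proof -
  have "(\<lambda>y. qhom X y x'' \<odot> qhom X x y) ` elts X \<subseteq> arrows (obj_of X x) (obj_of X x'')"
    if "x \<in> elts X" "x'' \<in> elts X" for x x''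
    using that by (auto intro!: comp_Hom[OF hom hom])
  then show ?thesis
    using assms by (auto simp: qcategory_def qrel_def qrel_le_def qrel_comp_def Sup_below_iff)
qed

lemma obj_of_PSh [simp]: "obj_of (PSh Q X) = fst"
  by (simp add: PSh_def)

text \<open>Over a category, the two-sided distributor condition on a presheaf reduces to the action
  inequality \<open>\<sigma>(x') \<odot> 1\<^sub>X(x, x') \<preceq> \<sigma>(x)\<close>.\<close>

lemma elts_PSh_iff:
  assumes X: "qcategory Q X"
  shows "\<sigma> \<in> elts (PSh Q X) \<longleftrightarrow>
    fst \<sigma> \<in> Obj Q \<and> snd \<sigma> \<in> extensional (elts X) \<and>
    (\<forall>x \<in> elts X. snd \<sigma> x \<in> arrows (obj_of X x) (fst \<sigma>)) \<and>
    (\<forall>x \<in> elts X. \<forall>x' \<in> elts X. snd \<sigma> x' \<odot> qhom X x x' \<preceq> snd \<sigma> x)"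
proof (cases "fst \<sigma> \<in> Obj Q \<and> (\<forall>x \<in> elts X. snd \<sigma> x \<in> arrows (obj_of X x) (fst \<sigma>))")
  case True
  then have s: "fst \<sigma> \<in> Obj Q"
    and \<sigma>: "\<And>x. x \<in> elts X \<Longrightarrow> snd \<sigma> x \<in> arrows (obj_of X x) (fst \<sigma>)" by auto
  have sub: "(\<lambda>x'. snd \<sigma> x' \<odot> qhom X x x') ` elts X \<subseteq> arrows (obj_of X x) (fst \<sigma>)"
    if "x \<in> elts X" for x
    using that by (auto intro!: comp_Hom[OF qcat_hom[OF X] \<sigma>])
  have S: "\<Squnion>\<^bsub>Hom Q (obj_of X x) (fst \<sigma>)\<^esub> ((\<lambda>x'. snd \<sigma> x' \<odot> qhom X x x') ` elts X)
      \<in> arrows (obj_of X x) (fst \<sigma>)" if "x \<in> elts X" for x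
    using Sup_arrows[OF qcat_obj[OF X that] s sub[OF that]] .
  have "qrel_comp Q X (point Q (fst \<sigma>)) (point Q (fst \<sigma>)) (qhom (point Q (fst \<sigma>)))
        (qrel_comp Q X X (point Q (fst \<sigma>)) (\<lambda>x _. snd \<sigma> x) (qhom X)) x ()
      = \<Squnion>\<^bsub>Hom Q (obj_of X x) (fst \<sigma>)\<^esub> {\<Squnion>\<^bsub>Hom Q (obj_of X x) (fst \<sigma>)\<^esub>
          ((\<lambda>x'. snd \<sigma> x' \<odot> qhom X x x') ` elts X)}" if "x \<in> elts X" for x
    using S[OF that] by (simp add: qrel_comp_def point_def comp_id_left)
  then show ?thesis
    using True S sub qcat_obj[OF X]
    by (auto simp: PSh_def distributor_def qrel_def qrel_le_def point_def Sup_below_iff)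
next
  case False
  then show ?thesis
    by (auto simp: PSh_def distributor_def qrel_def point_def)
qed

lemma PSh_obj: "qcategory Q X \<Longrightarrow> \<sigma> \<in> elts (PSh Q X) \<Longrightarrow> fst \<sigma> \<in> Obj Q"
  and PSh_ext: "qcategory Q X \<Longrightarrow> \<sigma> \<in> elts (PSh Q X) \<Longrightarrow> snd \<sigma> \<in> extensional (elts X)"
  and PSh_arrows: "qcategory Q X \<Longrightarrow> \<sigma> \<in> elts (PSh Q X) \<Longrightarrow> x \<in> elts X \<Longrightarrow>
    snd \<sigma> x \<in> arrows (obj_of X x) (fst \<sigma>)"
  and PSh_action: "qcategory Q X \<Longrightarrow> \<sigma> \<in> elts (PSh Q X) \<Longrightarrow> x \<in> elts X \<Longrightarrow> x' \<in> elts X \<Longrightarrow>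
    snd \<sigma> x' \<odot> qhom X x x' \<preceq> snd \<sigma> x"
  by (simp_all add: elts_PSh_iff)

lemma PSh_hom:
  assumes X: "qcategory Q X" and \<sigma>: "\<sigma> \<in> elts (PSh Q X)" and \<tau>: "\<tau> \<in> elts (PSh Q X)"
  shows PSh_hom_arrows: "qhom (PSh Q X) \<sigma> \<tau> \<in> arrows (fst \<sigma>) (fst \<tau>)"
    and below_PSh_hom_iff: "v \<in> arrows (fst \<sigma>) (fst \<tau>) \<Longrightarrow>
      v \<preceq> qhom (PSh Q X) \<sigma> \<tau> \<longleftrightarrow> (\<forall>x \<in> elts X. v \<odot> snd \<sigma> x \<preceq> snd \<tau> x)"
proof -
  have sub: "(\<lambda>x. residual Q (snd \<tau> x) (snd \<sigma> x)) ` elts X \<subseteq> arrows (fst \<sigma>) (fst \<tau>)"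
    using residual_arrows PSh_arrows[OF X \<sigma>] PSh_arrows[OF X \<tau>] by blast
  note obj = PSh_obj[OF X \<sigma>] PSh_obj[OF X \<tau>]
  show "qhom (PSh Q X) \<sigma> \<tau> \<in> arrows (fst \<sigma>) (fst \<tau>)"
    using Inf_arrows[OF obj sub] by (simp add: PSh_def)
  show "v \<preceq> qhom (PSh Q X) \<sigma> \<tau> \<longleftrightarrow> (\<forall>x \<in> elts X. v \<odot> snd \<sigma> x \<preceq> snd \<tau> x)"
    if "v \<in> arrows (fst \<sigma>) (fst \<tau>)"
    using below_Inf_iff[OF obj sub that]
      below_residual_iff[OF PSh_arrows[OF X \<sigma>] PSh_arrows[OF X \<tau>] that]
    by (simp add: PSh_def)
qed

lemma PSh_hom_app:
  assumes "qcategory Q X" "\<sigma> \<in> elts (PSh Q X)" "\<tau> \<in> elts (PSh Q X)" "x \<in> elts X"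
  shows "qhom (PSh Q X) \<sigma> \<tau> \<odot> snd \<sigma> x \<preceq> snd \<tau> x"
  using below_PSh_hom_iff[OF assms(1-3) PSh_hom_arrows[OF assms(1-3)]]
    below_refl[OF PSh_hom_arrows[OF assms(1-3)]] assms(4) by blast

lemma qcategory_PSh:
  assumes X: "qcategory Q X"
  shows "qcategory Q (PSh Q X)"
proof (rule qcategoryI)
  fix \<sigma> assume \<sigma>: "\<sigma> \<in> elts (PSh Q X)"
  show "obj_of (PSh Q X) \<sigma> \<in> Obj Q" using PSh_obj X \<sigma> by simp
  have "qid Q (fst \<sigma>) \<odot> snd \<sigma> x \<preceq> snd \<sigma> x" if "x \<in> elts X" for x
    using PSh_arrows[OF X \<sigma> that] by (simp add: comp_id_left below_refl)
  then show "qid Q (obj_of (PSh Q X) \<sigma>) \<preceq> qhom (PSh Q X) \<sigma> \<sigma>"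
    using below_PSh_hom_iff[OF X \<sigma> \<sigma>] id_Hom PSh_obj[OF X \<sigma>] by simp
next
  fix \<sigma> \<tau> assume "\<sigma> \<in> elts (PSh Q X)" "\<tau> \<in> elts (PSh Q X)"
  then show "qhom (PSh Q X) \<sigma> \<tau> \<in> arrows (obj_of (PSh Q X) \<sigma>) (obj_of (PSh Q X) \<tau>)"
    using PSh_hom_arrows X by simp
next
  fix \<sigma> \<tau> \<rho> assume e: "\<sigma> \<in> elts (PSh Q X)" "\<tau> \<in> elts (PSh Q X)" "\<rho> \<in> elts (PSh Q X)"
  let ?v = "qhom (PSh Q X) \<sigma> \<tau>" and ?w = "qhom (PSh Q X) \<tau> \<rho>"
  have v: "?v \<in> arrows (fst \<sigma>) (fst \<tau>)" and w: "?w \<in> arrows (fst \<tau>) (fst \<rho>)"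
    using PSh_hom_arrows[OF X] e by blast+
  have "(?w \<odot> ?v) \<odot> snd \<sigma> x \<preceq> snd \<rho> x" if x: "x \<in> elts X" for x
  proof -
    note a = PSh_arrows[OF X e(1) x] PSh_arrows[OF X e(2) x] PSh_arrows[OF X e(3) x]
    have "?w \<odot> (?v \<odot> snd \<sigma> x) \<preceq> ?w \<odot> snd \<tau> x"
      using comp_mono[OF below_refl[OF w] PSh_hom_app[OF X e(1,2) x]] w a v comp_Hom by blast
    then show ?thesis
      unfolding comp_assoc[OF a(1) v w]
      by (rule below_trans[OF _ PSh_hom_app[OF X e(2,3) x] comp_Hom[OF comp_Hom[OF a(1) v] w]
            comp_Hom[OF a(2) w] a(3)])
  qed
  then show "?w \<odot> ?v \<preceq> qhom (PSh Q X) \<sigma> \<rho>"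
    using below_PSh_hom_iff[OF X e(1,3) comp_Hom[OF v w]] by simp
qed

lemma elt_le_PSh_iff:
  assumes X: "qcategory Q X" and e: "\<sigma> \<in> elts (PSh Q X)" "\<tau> \<in> elts (PSh Q X)"
  shows "elt_le Q (PSh Q X) \<sigma> \<tau> \<longleftrightarrow> fst \<sigma> = fst \<tau> \<and> (\<forall>x \<in> elts X. snd \<sigma> x \<preceq> snd \<tau> x)"
  using below_PSh_hom_iff[OF X e] id_Hom[OF PSh_obj[OF X e(1)]]
    comp_id_left[OF PSh_arrows[OF X e(1)]]
  by (auto simp: elt_le_def)

lemma PSh_eqI:
  assumes X: "qcategory Q X" and e: "\<sigma> \<in> elts (PSh Q X)" "\<tau> \<in> elts (PSh Q X)"
    and "fst \<sigma> = fst \<tau>" "\<And>x. x \<in> elts X \<Longrightarrow> snd \<sigma> x = snd \<tau> x"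
  shows "\<sigma> = \<tau>"
  using assms(4,5) extensionalityI[OF PSh_ext[OF X e(1)] PSh_ext[OF X e(2)]]
  by (intro prod_eqI) auto

lemma PSh_antisym:
  assumes X: "qcategory Q X" and e: "\<sigma> \<in> elts (PSh Q X)" "\<tau> \<in> elts (PSh Q X)"
    and le: "elt_le Q (PSh Q X) \<sigma> \<tau>" "elt_le Q (PSh Q X) \<tau> \<sigma>"
  shows "\<sigma> = \<tau>"
proof (rule PSh_eqI[OF X e])
  show f: "fst \<sigma> = fst \<tau>" using le by (simp add: elt_le_def)
  show "snd \<sigma> x = snd \<tau> x" if "x \<in> elts X" for x
    using le e f that PSh_arrows[OF X e(1) that] PSh_arrows[OF X e(2) that]
    by (intro below_antisym[of _ _ "obj_of X x" "fst \<sigma>"]) (simp_all add: elt_le_PSh_iff[OF X])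
qed

lemma elt_le_refl: "qcategory Q X \<Longrightarrow> x \<in> elts X \<Longrightarrow> elt_le Q X x x"
  by (simp add: elt_le_def qcat_id)

lemma elt_le_trans:
  assumes X: "qcategory Q X" and e: "x \<in> elts X" "x' \<in> elts X" "x'' \<in> elts X"
    and le: "elt_le Q X x x'" "elt_le Q X x' x''"
  shows "elt_le Q X x x''"
proof -
  define r where "r = obj_of X x"
  have o: "obj_of X x = r" "obj_of X x' = r" "obj_of X x'' = r"
    using le by (auto simp: elt_le_def r_def)
  have h: "qhom X x x' \<in> arrows r r" "qhom X x' x'' \<in> arrows r r" "qhom X x x'' \<in> arrows r r"
    using qcat_hom[OF X e(1,2)] qcat_hom[OF X e(2,3)] qcat_hom[OF X e(1,3)] o by auto
  have i: "qid Q r \<in> arrows r r" using id_Hom qcat_obj[OF X e(1)] o by simp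
  have "qid Q r \<preceq> qhom X x x'" "qid Q r \<preceq> qhom X x' x''"
    using le unfolding elt_le_def o by auto
  then have "qid Q r \<odot> qid Q r \<preceq> qhom X x' x'' \<odot> qhom X x x'"
    using i h by (blast intro: comp_mono)
  then have "qid Q r \<preceq> qhom X x' x'' \<odot> qhom X x x'"
    by (simp only: comp_id_left[OF i])
  then have "qid Q r \<preceq> qhom X x x''"
    by (rule below_trans[OF _ qcat_comp[OF X e] i comp_Hom[OF h(1,2)] h(3)])
  then show ?thesis using o by (simp add: elt_le_def)
qed

lemma qfunctor_elts: "qfunctor Q X Y f \<Longrightarrow> x \<in> elts X \<Longrightarrow> f x \<in> elts Y"
  and qfunctor_obj: "qfunctor Q X Y f \<Longrightarrow> x \<in> elts X \<Longrightarrow> obj_of Y (f x) = obj_of X x"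
  and qfunctor_hom: "qfunctor Q X Y f \<Longrightarrow> x \<in> elts X \<Longrightarrow> x' \<in> elts X \<Longrightarrow>
    qhom X x x' \<preceq> qhom Y (f x) (f x')"
  by (auto simp: qfunctor_def)

lemma qfunctor_mono:
  assumes X: "qcategory Q X" and Y: "qcategory Q Y" and f: "qfunctor Q X Y f"
    and e: "x \<in> elts X" "x' \<in> elts X" and le: "elt_le Q X x x'"
  shows "elt_le Q Y (f x) (f x')"
proof -
  define r where "r = obj_of X x"
  have o: "obj_of X x = r" "obj_of X x' = r" "obj_of Y (f x) = r" "obj_of Y (f x') = r"
    using le qfunctor_obj[OF f e(1)] qfunctor_obj[OF f e(2)] by (auto simp: elt_le_def r_def)
  have "qid Q r \<preceq> qhom X x x'"
    using le unfolding elt_le_def o by auto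
  then have "qid Q r \<preceq> qhom Y (f x) (f x')"
    using below_trans[OF _ qfunctor_hom[OF f e], of _ r r] qcat_hom[OF X e]
      qcat_hom[OF Y qfunctor_elts[OF f e(1)] qfunctor_elts[OF f e(2)]]
      id_Hom[OF qcat_obj[OF X e(1)]]
    unfolding o by blast
  then show ?thesis by (simp add: elt_le_def o)
qed

lemma qfunctor_comp:
  assumes "qcategory Q X" "qcategory Q Y" "qcategory Q Z"
    and f: "qfunctor Q X Y f" and g: "qfunctor Q Y Z g"
  shows "qfunctor Q X Z (g \<circ> f)"
proof -
  have "qhom X x x' \<preceq> qhom Z (g (f x)) (g (f x'))" if e: "x \<in> elts X" "x' \<in> elts X" for x x'
  proof (rule below_trans[OF qfunctor_hom[OF f e]
        qfunctor_hom[OF g qfunctor_elts[OF f e(1)] qfunctor_elts[OF f e(2)]]])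
    note qfunctor_elts[OF f e(1)] qfunctor_elts[OF f e(2)]
    then show "qhom X x x' \<in> arrows (obj_of X x) (obj_of X x')"
      "qhom Y (f x) (f x') \<in> arrows (obj_of X x) (obj_of X x')"
      "qhom Z (g (f x)) (g (f x')) \<in> arrows (obj_of X x) (obj_of X x')"
      using qcat_hom[OF assms(1)] qcat_hom[OF assms(2), of "f x" "f x'"] e
        qcat_hom[OF assms(3), of "g (f x)" "g (f x')"] qfunctor_obj[OF f] qfunctor_obj[OF g]
        qfunctor_elts[OF g] by auto
  qed
  then show ?thesis
    using f g by (simp add: qfunctor_def image_subset_iff)
qed

lemma qfunctor_id: "qcategory Q X \<Longrightarrow> qfunctor Q X X id"
  using qcat_hom below_refl by (fastforce simp: qfunctor_def)

lemma qfunctor_cong: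
  assumes "\<And>x. x \<in> elts X \<Longrightarrow> f x = g x"
  shows "qfunctor Q X Y f \<longleftrightarrow> qfunctor Q X Y g"
  using assms by (simp add: qfunctor_def image_subset_iff)

end

section \<open>The Yoneda lemma\<close>

context quantaloid
begin

lemma fst_yoneda [simp]: "fst (yoneda X x) = obj_of X x"
  and snd_yoneda [simp]: "x' \<in> elts X \<Longrightarrow> snd (yoneda X x) x' = qhom X x' x"
  by (simp_all add: yoneda_def)

lemma yoneda_elts:
  assumes X: "qcategory Q X" and x: "x \<in> elts X"
  shows "yoneda X x \<in> elts (PSh Q X)"
  unfolding elts_PSh_iff[OF X]
  using qcat_obj[OF X x] qcat_hom[OF X _ x] qcat_comp[OF X _ _ x]
  by (simp add: yoneda_def)

text \<open>One half evaluates at \<open>x\<close> and uses \<open>1 \<preceq> 1\<^sub>X(x, x)\<close>; the other half is the action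
  inequality of the presheaf \<open>\<sigma>\<close>.\<close>

lemma yoneda_lemma:
  assumes X: "qcategory Q X" and x: "x \<in> elts X" and \<sigma>: "\<sigma> \<in> elts (PSh Q X)"
  shows "qhom (PSh Q X) (yoneda X x) \<sigma> = snd \<sigma> x"
proof (rule below_antisym)
  let ?h = "qhom (PSh Q X) (yoneda X x) \<sigma>"
  note y = yoneda_elts[OF X x]
  note iff = below_PSh_hom_iff[OF X y \<sigma>, simplified]
  show h: "?h \<in> arrows (obj_of X x) (fst \<sigma>)"
    using PSh_hom_arrows[OF X y \<sigma>] by simp
  show s: "snd \<sigma> x \<in> arrows (obj_of X x) (fst \<sigma>)"
    using PSh_arrows[OF X \<sigma> x] .
  note i = id_Hom[OF qcat_obj[OF X x]]
  have "?h \<odot> qid Q (obj_of X x) \<preceq> ?h \<odot> qhom X x x"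
    by (rule comp_mono[OF below_refl[OF h] qcat_id[OF X x] h h i qcat_hom[OF X x x]])
  then have "?h \<preceq> ?h \<odot> qhom X x x"
    by (simp add: comp_id_right[OF h])
  moreover have "?h \<odot> qhom X x x \<preceq> snd \<sigma> x"
    using PSh_hom_app[OF X y \<sigma> x] x by simp
  ultimately show "?h \<preceq> snd \<sigma> x"
    by (rule below_trans[OF _ _ h comp_Hom[OF qcat_hom[OF X x x] h] s])
  show "snd \<sigma> x \<preceq> ?h"
    unfolding iff[OF s] using PSh_action[OF X \<sigma> _ x] by simp
qed

lemma qfunctor_yoneda:
  assumes X: "qcategory Q X"
  shows "qfunctor Q X (PSh Q X) (yoneda X)"
proof -
  have "qhom X x x' \<preceq> qhom (PSh Q X) (yoneda X x) (yoneda X x')"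
    if "x \<in> elts X" "x' \<in> elts X" for x x'
    using yoneda_lemma[OF X _ yoneda_elts[OF X]] below_refl[OF qcat_hom[OF X]] that by simp
  then show ?thesis
    using yoneda_elts[OF X] by (simp add: qfunctor_def image_subset_iff)
qed

end

section \<open>Weighted colimits of presheaves\<close>

context quantaloid
begin

text \<open>The colimit of the diagram \<open>g : A \<rightarrow> \<P>X\<close> weighted by a presheaf \<open>\<sigma>\<close> on \<open>A\<close>,
  that is, the extension of \<open>g\<close> along the Yoneda embedding of \<open>A\<close>.\<close>

definition colim :: "('c, 'o, 'm) qcat \<Rightarrow> ('a, 'o, 'm) qcat \<Rightarrow> ('c \<Rightarrow> ('a, 'o, 'm) presheaf)
    \<Rightarrow> ('c, 'o, 'm) presheaf \<Rightarrow> ('a, 'o, 'm) presheaf" where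
  "colim A X g \<sigma> =
     (fst \<sigma>, restrict
        (\<lambda>x. \<Squnion>\<^bsub>Hom Q (obj_of X x) (fst \<sigma>)\<^esub> ((\<lambda>a. snd \<sigma> a \<odot> snd (g a) x) ` elts A))
        (elts X))"

lemma fst_colim [simp]: "fst (colim A X g \<sigma>) = fst \<sigma>"
  by (simp add: colim_def)

lemma colim_cong:
  assumes "\<And>a. a \<in> elts A \<Longrightarrow> g a = g' a"
  shows "colim A X g = colim A X g'"
  using assms by (intro ext) (simp add: colim_def cong: image_cong)

context
  fixes A :: "('c, 'o, 'm) qcat" and X :: "('a, 'o, 'm) qcat"
    and g :: "'c \<Rightarrow> ('a, 'o, 'm) presheaf"
  assumes A: "qcategory Q A" and X: "qcategory Q X" and g: "qfunctor Q A (PSh Q X) g"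
begin

lemma diagram_arrows: "a \<in> elts A \<Longrightarrow> x \<in> elts X \<Longrightarrow> snd (g a) x \<in> arrows (obj_of X x) (obj_of A a)"
  using PSh_arrows[OF X qfunctor_elts[OF g]] qfunctor_obj[OF g] by simp

context
  fixes \<sigma> assumes \<sigma>: "\<sigma> \<in> elts (PSh Q A)"
begin

lemma colim_term_arrows:
  "a \<in> elts A \<Longrightarrow> x \<in> elts X \<Longrightarrow> snd \<sigma> a \<odot> snd (g a) x \<in> arrows (obj_of X x) (fst \<sigma>)"
  by (rule comp_Hom[OF diagram_arrows PSh_arrows[OF A \<sigma>]])

lemma colim_terms:
  "x \<in> elts X \<Longrightarrow>
    (\<lambda>a. snd \<sigma> a \<odot> snd (g a) x) ` elts A \<subseteq> arrows (obj_of X x) (fst \<sigma>)"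
  using colim_term_arrows by blast

lemma colim_arrows: "x \<in> elts X \<Longrightarrow> snd (colim A X g \<sigma>) x \<in> arrows (obj_of X x) (fst \<sigma>)"
  using Sup_arrows[OF qcat_obj[OF X] PSh_obj[OF A \<sigma>] colim_terms] by (simp add: colim_def)

lemma colim_below_iff:
  assumes "x \<in> elts X" "w \<in> arrows (obj_of X x) (fst \<sigma>)"
  shows "snd (colim A X g \<sigma>) x \<preceq> w \<longleftrightarrow> (\<forall>a \<in> elts A. snd \<sigma> a \<odot> snd (g a) x \<preceq> w)"
  using Sup_below_iff[OF qcat_obj[OF X] PSh_obj[OF A \<sigma>] colim_terms] assms
  by (simp add: colim_def)

lemma comp_colim_below_iff:
  assumes "x \<in> elts X" "v \<in> arrows (fst \<sigma>) t" "w \<in> arrows (obj_of X x) t"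
  shows "v \<odot> snd (colim A X g \<sigma>) x \<preceq> w \<longleftrightarrow>
    (\<forall>a \<in> elts A. v \<odot> snd \<sigma> a \<odot> snd (g a) x \<preceq> w)"
  using comp_Sup_below_iff[OF assms(2) qcat_obj[OF X assms(1)] colim_terms[OF assms(1)] assms(3)]
    assms by (simp add: colim_def)

lemma colim_comp_below_iff:
  assumes "x \<in> elts X" "u \<in> arrows r (obj_of X x)" "w \<in> arrows r (fst \<sigma>)"
  shows "snd (colim A X g \<sigma>) x \<odot> u \<preceq> w \<longleftrightarrow>
    (\<forall>a \<in> elts A. (snd \<sigma> a \<odot> snd (g a) x) \<odot> u \<preceq> w)"
  using Sup_comp_below_iff[OF assms(2) PSh_obj[OF A \<sigma>] colim_terms[OF assms(1)] assms(3)]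
    assms by (simp add: colim_def)

lemma colim_upper:
  assumes "a \<in> elts A" "x \<in> elts X"
  shows "snd \<sigma> a \<odot> snd (g a) x \<preceq> snd (colim A X g \<sigma>) x"
  using colim_below_iff[OF assms(2) colim_arrows] below_refl[OF colim_arrows] assms by blast

lemma colim_elts: "colim A X g \<sigma> \<in> elts (PSh Q X)"
proof -
  have "snd (colim A X g \<sigma>) x' \<odot> qhom X x x' \<preceq> snd (colim A X g \<sigma>) x"
    if x: "x \<in> elts X" "x' \<in> elts X" for x x'
  proof -
    note h = qcat_hom[OF X x]
    have "(snd \<sigma> a \<odot> snd (g a) x') \<odot> qhom X x x' \<preceq> snd (colim A X g \<sigma>) x"
      if a: "a \<in> elts A" for a
    proof -
      note d = diagram_arrows[OF a x(1)] and d' = diagram_arrows[OF a x(2)]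
        and s = PSh_arrows[OF A \<sigma> a]
      have "snd \<sigma> a \<odot> snd (g a) x' \<odot> qhom X x x' \<preceq> snd \<sigma> a \<odot> snd (g a) x"
        using PSh_action[OF X qfunctor_elts[OF g a] x]
        by (rule comp_mono[OF below_refl[OF s] _ s s comp_Hom[OF h d'] d])
      then show ?thesis
        unfolding comp_assoc[OF h d' s]
        by (rule below_trans[OF _ colim_upper[OF a x(1)] comp_Hom[OF comp_Hom[OF h d'] s]
              comp_Hom[OF d s] colim_arrows[OF x(1)]])
    qed
    then show ?thesis
      using colim_comp_below_iff[OF x(2) h colim_arrows[OF x(1)]] by blast
  qed
  then show ?thesis
    unfolding elts_PSh_iff[OF X]
    using PSh_obj[OF A \<sigma>] colim_arrows by (simp add: colim_def)
qed

end

lemma qfunctor_colim: "qfunctor Q (PSh Q A) (PSh Q X) (colim A X g)"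
proof -
  have "qhom (PSh Q A) \<sigma> \<tau> \<preceq> qhom (PSh Q X) (colim A X g \<sigma>) (colim A X g \<tau>)"
    if e: "\<sigma> \<in> elts (PSh Q A)" "\<tau> \<in> elts (PSh Q A)" for \<sigma> \<tau>
  proof -
    let ?h = "qhom (PSh Q A) \<sigma> \<tau>"
    note h = PSh_hom_arrows[OF A e]
    have "?h \<odot> snd (colim A X g \<sigma>) x \<preceq> snd (colim A X g \<tau>) x" if x: "x \<in> elts X" for x
    proof -
      have "?h \<odot> snd \<sigma> a \<odot> snd (g a) x \<preceq> snd (colim A X g \<tau>) x" if a: "a \<in> elts A" for a
      proof -
        note d = diagram_arrows[OF a x] and s = PSh_arrows[OF A e(1) a]
          and t = PSh_arrows[OF A e(2) a]
        have "(?h \<odot> snd \<sigma> a) \<odot> snd (g a) x \<preceq> snd \<tau> a \<odot> snd (g a) x"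
          by (rule comp_mono[OF PSh_hom_app[OF A e a] below_refl[OF d] comp_Hom[OF s h] t d d])
        then show ?thesis
          unfolding comp_assoc[OF d s h]
          by (rule below_trans[OF _ colim_upper[OF e(2) a x] comp_Hom[OF comp_Hom[OF d s] h]
                comp_Hom[OF d t] colim_arrows[OF e(2) x]])
      qed
      then show ?thesis
        using comp_colim_below_iff[OF e(1) x h colim_arrows[OF e(2) x]] by blast
    qed
    then show ?thesis
      using below_PSh_hom_iff[OF X colim_elts[OF e(1)] colim_elts[OF e(2)]] h by simp
  qed
  then show ?thesis
    using colim_elts by (simp add: qfunctor_def image_subset_iff)
qed

text \<open>Weighting by a representable evaluates the diagram: the term at \<open>a\<close> already attains the
  value, because \<open>1 \<preceq> 1\<^sub>A(a, a)\<close>, and every other term lies below it, because \<open>g\<close> is a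
  functor.\<close>

lemma colim_yoneda:
  assumes a: "a \<in> elts A"
  shows "colim A X g (yoneda A a) = g a"
proof (rule PSh_eqI[OF X colim_elts[OF yoneda_elts[OF A a]] qfunctor_elts[OF g a]])
  show "fst (colim A X g (yoneda A a)) = fst (g a)"
    using qfunctor_obj[OF g a] by simp
  fix x assume x: "x \<in> elts X"
  note y = yoneda_elts[OF A a]
  note d = diagram_arrows[OF a x]
  have c: "snd (colim A X g (yoneda A a)) x \<in> arrows (obj_of X x) (obj_of A a)"
    using colim_arrows[OF y x] by simp
  show "snd (colim A X g (yoneda A a)) x = snd (g a) x"
  proof (rule below_antisym[OF _ _ c d])
    have "qhom A b a \<odot> snd (g b) x \<preceq> snd (g a) x" if b: "b \<in> elts A" for b
    proof -
      let ?k = "qhom (PSh Q X) (g b) (g a)"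
      note db = diagram_arrows[OF b x] and h = qcat_hom[OF A b a]
      have k: "?k \<in> arrows (obj_of A b) (obj_of A a)"
        using PSh_hom_arrows[OF X qfunctor_elts[OF g b] qfunctor_elts[OF g a]]
          qfunctor_obj[OF g a] qfunctor_obj[OF g b] by simp
      have "qhom A b a \<odot> snd (g b) x \<preceq> ?k \<odot> snd (g b) x"
        by (rule comp_mono[OF qfunctor_hom[OF g b a] below_refl[OF db] h k db db])
      then show ?thesis
        by (rule below_trans[OF _ PSh_hom_app[OF X qfunctor_elts[OF g b] qfunctor_elts[OF g a] x]
              comp_Hom[OF db h] comp_Hom[OF db k] d])
    qed
    then show "snd (colim A X g (yoneda A a)) x \<preceq> snd (g a) x"
      using colim_below_iff[OF y x] d by simp
  next
    note i = id_Hom[OF qcat_obj[OF A a]] and h = qcat_hom[OF A a a]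
    have "qid Q (obj_of A a) \<odot> snd (g a) x \<preceq> qhom A a a \<odot> snd (g a) x"
      by (rule comp_mono[OF qcat_id[OF A a] below_refl[OF d] i h d d])
    moreover have "qhom A a a \<odot> snd (g a) x \<preceq> snd (colim A X g (yoneda A a)) x"
      using colim_upper[OF y a x] a by simp
    ultimately show "snd (g a) x \<preceq> snd (colim A X g (yoneda A a)) x"
      unfolding comp_id_left[OF d]
      by (rule below_trans[OF _ _ d comp_Hom[OF d h] c])
  qed
qed

end

text \<open>Both sides are the join of the triple composites \<open>\<Sigma>(b) \<odot> k(b)(a) \<odot> g(a)(x)\<close> over all
  \<open>a\<close> and \<open>b\<close>, so they have the same upper bounds.\<close>

lemma colim_colim:
  assumes A: "qcategory Q A" and X: "qcategory Q X" and g: "qfunctor Q A (PSh Q X) g"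
    and B: "qcategory Q B" and k: "qfunctor Q B (PSh Q A) k" and \<Sigma>: "\<Sigma> \<in> elts (PSh Q B)"
  shows "colim A X g (colim B A k \<Sigma>) = colim B X (colim A X g \<circ> k) \<Sigma>"
proof -
  note gk = qfunctor_comp[OF B qcategory_PSh[OF A] qcategory_PSh[OF X] k qfunctor_colim[OF A X g]]
  note c = colim_elts[OF B A k \<Sigma>]
  note R = colim_elts[OF B X gk \<Sigma>]
  show ?thesis
  proof (rule PSh_eqI[OF X colim_elts[OF A X g c] R])
    fix x assume x: "x \<in> elts X"
    show "snd (colim A X g (colim B A k \<Sigma>)) x = snd (colim B X (colim A X g \<circ> k) \<Sigma>) x"
    proof (rule arrow_eqI)
      show "snd (colim A X g (colim B A k \<Sigma>)) x \<in> arrows (obj_of X x) (fst \<Sigma>)"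
        using colim_arrows[OF A X g c x] by simp
      show "snd (colim B X (colim A X g \<circ> k) \<Sigma>) x \<in> arrows (obj_of X x) (fst \<Sigma>)"
        by (rule colim_arrows[OF B X gk \<Sigma> x])
      fix w assume w: "w \<in> arrows (obj_of X x) (fst \<Sigma>)"
      let ?kk = "\<lambda>a b. snd (k b) a" and ?gg = "\<lambda>a. snd (g a) x"
      have "snd (colim A X g (colim B A k \<Sigma>)) x \<preceq> w
          \<longleftrightarrow> (\<forall>a \<in> elts A. snd (colim B A k \<Sigma>) a \<odot> ?gg a \<preceq> w)"
        using colim_below_iff[OF A X g c x] w by simp
      also have "\<dots> \<longleftrightarrow> (\<forall>a \<in> elts A. \<forall>b \<in> elts B. (snd \<Sigma> b \<odot> ?kk a b) \<odot> ?gg a \<preceq> w)"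
        using colim_comp_below_iff[OF B A k \<Sigma> _ diagram_arrows[OF A X g _ x] w]
        by simp
      also have "\<dots> \<longleftrightarrow> (\<forall>b \<in> elts B. \<forall>a \<in> elts A. snd \<Sigma> b \<odot> ?kk a b \<odot> ?gg a \<preceq> w)"
        using comp_assoc[OF diagram_arrows[OF A X g _ x]
            diagram_arrows[OF B A k] PSh_arrows[OF B \<Sigma>]]
        by auto
      also have "\<dots> \<longleftrightarrow> (\<forall>b \<in> elts B. snd \<Sigma> b \<odot> snd (colim A X g (k b)) x \<preceq> w)"
        using comp_colim_below_iff[OF A X g qfunctor_elts[OF k] x _ w] PSh_arrows[OF B \<Sigma>]
          qfunctor_obj[OF k] by simp
      also have "\<dots> \<longleftrightarrow> snd (colim B X (colim A X g \<circ> k) \<Sigma>) x \<preceq> w"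
        using colim_below_iff[OF B X gk \<Sigma> x w] by simp
      finally show "snd (colim A X g (colim B A k \<Sigma>)) x \<preceq> w
          \<longleftrightarrow> snd (colim B X (colim A X g \<circ> k) \<Sigma>) x \<preceq> w" .
    qed
  qed simp
qed

text \<open>The density of representables: the term at \<open>x\<close> attains \<open>\<sigma>(x)\<close> because
  \<open>1 \<preceq> 1\<^sub>X(x, x)\<close>, and the action inequality bounds all other terms by it.\<close>

lemma colim_of_yoneda:
  assumes X: "qcategory Q X" and \<sigma>: "\<sigma> \<in> elts (PSh Q X)"
  shows "colim X X (yoneda X) \<sigma> = \<sigma>"
proof (rule PSh_eqI[OF X colim_elts[OF X X qfunctor_yoneda[OF X] \<sigma>] \<sigma>])
  note y = qfunctor_yoneda[OF X]
  fix x assume x: "x \<in> elts X"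
  note c = colim_arrows[OF X X y \<sigma> x] and s = PSh_arrows[OF X \<sigma> x]
    and i = id_Hom[OF qcat_obj[OF X x]] and h = qcat_hom[OF X x x]
  show "snd (colim X X (yoneda X) \<sigma>) x = snd \<sigma> x"
  proof (rule below_antisym[OF _ _ c s])
    show "snd (colim X X (yoneda X) \<sigma>) x \<preceq> snd \<sigma> x"
      using colim_below_iff[OF X X y \<sigma> x s] PSh_action[OF X \<sigma> x] x by simp
    have "snd \<sigma> x \<odot> qid Q (obj_of X x) \<preceq> snd \<sigma> x \<odot> qhom X x x"
      by (rule comp_mono[OF below_refl[OF s] qcat_id[OF X x] s s i h])
    moreover have "snd \<sigma> x \<odot> qhom X x x \<preceq> snd (colim X X (yoneda X) \<sigma>) x"
      using colim_upper[OF X X y \<sigma> x x] x by simp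
    ultimately show "snd \<sigma> x \<preceq> snd (colim X X (yoneda X) \<sigma>) x"
      unfolding comp_id_right[OF s] by (rule below_trans[OF _ _ s comp_Hom[OF h s] c])
  qed
qed simp

end

section \<open>The presheaf monad and its suprema\<close>

context quantaloid
begin

lemma push_eq_colim: "push Q X Y f = colim X Y (yoneda Y \<circ> f)"
  by (rule ext) (simp add: push_def colim_def qrel_comp_def upper_star_def point_def
      cong: image_cong restrict_cong)

text \<open>The pullback along the Yoneda embedding at \<open>x\<close> is the join of
  \<open>\<Sigma>(\<sigma>) \<odot> 1\<^sub>P\<^sub>X(y x, \<sigma>)\<close>, and the Yoneda lemma turns the second factor into \<open>\<sigma>(x)\<close>.\<close>

lemma mult_eq_colim:
  assumes X: "qcategory Q X"
  shows "mult Q X = colim (PSh Q X) X id"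
  using yoneda_lemma[OF X]
  by (intro ext) (simp add: mult_def pull_def colim_def qrel_comp_def lower_star_def point_def
      cong: image_cong restrict_cong)

lemma qfunctor_push:
  assumes "qcategory Q X" "qcategory Q Y" "qfunctor Q X Y f"
  shows "qfunctor Q (PSh Q X) (PSh Q Y) (push Q X Y f)"
  unfolding push_eq_colim using assms qfunctor_yoneda qcategory_PSh
  by (blast intro: qfunctor_colim qfunctor_comp)

lemma qfunctor_mult: "qcategory Q X \<Longrightarrow> qfunctor Q (PSh Q (PSh Q X)) (PSh Q X) (mult Q X)"
  by (simp add: mult_eq_colim qfunctor_colim qcategory_PSh qfunctor_id)

lemma push_yoneda:
  assumes "qcategory Q X" "qcategory Q Y" "qfunctor Q X Y f" "x \<in> elts X"
  shows "push Q X Y f (yoneda X x) = yoneda Y (f x)"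
  using colim_yoneda[OF assms(1,2) qfunctor_comp[OF assms(1,2) qcategory_PSh[OF assms(2)]
        assms(3) qfunctor_yoneda[OF assms(2)]] assms(4)]
  by (simp add: push_eq_colim)

lemma mult_yoneda:
  assumes "qcategory Q X" "\<sigma> \<in> elts (PSh Q X)"
  shows "mult Q X (yoneda (PSh Q X) \<sigma>) = \<sigma>"
  using colim_yoneda[OF qcategory_PSh[OF assms(1)] assms(1) qfunctor_id[OF qcategory_PSh[OF assms(1)]]]
    assms by (simp add: mult_eq_colim)

text \<open>Since the multiplication inverts Yoneda, it turns the colimit of the representables
  \<open>y(g a)\<close> into the colimit of the \<open>g a\<close> themselves.\<close>

lemma mult_push:
  assumes A: "qcategory Q A" and X: "qcategory Q X" and g: "qfunctor Q A (PSh Q X) g"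
    and \<sigma>: "\<sigma> \<in> elts (PSh Q A)"
  shows "mult Q X (push Q A (PSh Q X) g \<sigma>) = colim A X g \<sigma>"
proof -
  let ?y = "yoneda (PSh Q X)"
  note PX = qcategory_PSh[OF X]
  note PPX = qcategory_PSh[OF PX]
  have "mult Q X (push Q A (PSh Q X) g \<sigma>) = colim A X (mult Q X \<circ> (?y \<circ> g)) \<sigma>"
    unfolding push_eq_colim mult_eq_colim[OF X]
    by (rule colim_colim[OF PX X qfunctor_id[OF PX] A
          qfunctor_comp[OF A PX PPX g qfunctor_yoneda[OF PX]] \<sigma>])
  also have "colim A X (mult Q X \<circ> (?y \<circ> g)) = colim A X g"
    by (rule colim_cong) (simp add: mult_yoneda[OF X] qfunctor_elts[OF g])
  finally show ?thesis .
qed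

text \<open>Colimits preserve suprema.  For \<open>g = y \<cdot> f\<close> this gives naturality of the multiplication,
  and for \<open>g = 1\<close> its associativity.\<close>

lemma colim_mult:
  assumes A: "qcategory Q A" and X: "qcategory Q X" and g: "qfunctor Q A (PSh Q X) g"
    and \<Sigma>: "\<Sigma> \<in> elts (PSh Q (PSh Q A))"
  shows "colim A X g (mult Q A \<Sigma>) = colim (PSh Q A) X (colim A X g) \<Sigma>"
  using colim_colim[OF A X g qcategory_PSh[OF A] qfunctor_id[OF qcategory_PSh[OF A]] \<Sigma>]
  by (simp add: mult_eq_colim[OF A])

text \<open>This is the unit of the adjunction between the multiplication and Yoneda: evaluated at
  \<open>\<sigma>\<close> it says \<open>\<Sigma>(\<sigma>) \<preceq> 1\<^sub>P\<^sub>X(\<sigma>, s \<Sigma>)\<close>, that is, \<open>\<Sigma>(\<sigma>) \<odot> \<sigma>(x) \<preceq> (s \<Sigma>)(x)\<close> for all \<open>x\<close>,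
  and the left-hand sides are the terms of the join defining \<open>(s \<Sigma>)(x)\<close>.\<close>

lemma below_yoneda_mult:
  assumes X: "qcategory Q X" and \<Sigma>: "\<Sigma> \<in> elts (PSh Q (PSh Q X))"
  shows "elt_le Q (PSh Q (PSh Q X)) \<Sigma> (yoneda (PSh Q X) (mult Q X \<Sigma>))"
proof -
  note PX = qcategory_PSh[OF X]
  note S = qfunctor_elts[OF qfunctor_mult[OF X] \<Sigma>]
  note S1 = qfunctor_obj[OF qfunctor_mult[OF X] \<Sigma>, simplified]
  have "snd \<Sigma> \<sigma> \<preceq> qhom (PSh Q X) \<sigma> (mult Q X \<Sigma>)" if \<sigma>: "\<sigma> \<in> elts (PSh Q X)" for \<sigma>
    using below_PSh_hom_iff[OF X \<sigma> S] PSh_arrows[OF PX \<Sigma> \<sigma>] S1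
      colim_upper[OF PX X qfunctor_id[OF PX] \<Sigma> \<sigma>] by (simp add: mult_eq_colim[OF X])
  then show ?thesis
    using elt_le_PSh_iff[OF PX \<Sigma> yoneda_elts[OF PX S]] S1 by simp
qed

lemma left_adjoint_mult:
  assumes X: "qcategory Q X"
  shows "left_adjoint Q (PSh Q (PSh Q X)) (PSh Q X) (mult Q X) (yoneda (PSh Q X))"
  using qfunctor_mult[OF X] qfunctor_yoneda[OF qcategory_PSh[OF X]] below_yoneda_mult[OF X]
    mult_yoneda[OF X] elt_le_refl[OF qcategory_PSh[OF X]]
  by (simp add: left_adjoint_def qfun_le_def)

text \<open>Left adjoints of the same functor are comparable in both directions, by
  \<open>f \<le> f \<cdot> g \<cdot> f' \<le> f'\<close>.\<close>

lemma left_adjoint_below: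
  assumes X: "qcategory Q X" and Y: "qcategory Q Y"
    and f: "left_adjoint Q X Y f g" and f': "left_adjoint Q X Y f' g" and x: "x \<in> elts X"
  shows "elt_le Q Y (f x) (f' x)"
proof -
  have F: "qfunctor Q X Y f" "qfunctor Q X Y f'" "qfunctor Q Y X g"
    using f f' by (auto simp: left_adjoint_def)
  note e = qfunctor_elts[OF F(1) x] qfunctor_elts[OF F(2) x]
  note ge = qfunctor_elts[OF F(3) e(2)]
  have "elt_le Q X x (g (f' x))"
    using f' x by (simp add: left_adjoint_def qfun_le_def)
  then have "elt_le Q Y (f x) (f (g (f' x)))"
    by (rule qfunctor_mono[OF X Y F(1) x ge])
  moreover have "elt_le Q Y (f (g (f' x))) (f' x)"
    using f e by (simp add: left_adjoint_def qfun_le_def)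
  ultimately show ?thesis
    by (rule elt_le_trans[OF Y e(1) qfunctor_elts[OF F(1) ge] e(2)])
qed

text \<open>The choice in the definition of the supremum is harmless here because presheaf
  categories are separated; outside the presheaves the two functions may differ.\<close>

lemma sup_map_PSh:
  assumes X: "qcategory Q X" and \<Sigma>: "\<Sigma> \<in> elts (PSh Q (PSh Q X))"
  shows "sup_map Q (PSh Q X) \<Sigma> = mult Q X \<Sigma>"
proof -
  note PX = qcategory_PSh[OF X]
  note PPX = qcategory_PSh[OF PX]
  note m = left_adjoint_mult[OF X]
  have s: "left_adjoint Q (PSh Q (PSh Q X)) (PSh Q X) (sup_map Q (PSh Q X)) (yoneda (PSh Q X))"
    unfolding sup_map_def by (rule someI[of _ "mult Q X"]) (rule m)
  show ?thesis
    using left_adjoint_below[OF PPX PX s m \<Sigma>] left_adjoint_below[OF PPX PX m s \<Sigma>] s m \<Sigma>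
    by (intro PSh_antisym[OF X]) (auto simp: left_adjoint_def intro: qfunctor_elts)
qed

lemma yoneda_sup_law_eq:
  assumes "qcategory Q X" "\<Sigma> \<in> elts (PSh Q (PSh Q X))"
  shows "yoneda_sup_law Q X \<Sigma> = yoneda (PSh Q X) (mult Q X \<Sigma>)"
  using sup_map_PSh[OF assms] by (simp add: yoneda_sup_law_def)

lemma qfunctor_yoneda_sup_law:
  assumes X: "qcategory Q X"
  shows "qfunctor Q (PSh Q (PSh Q X)) (PSh Q (PSh Q X)) (yoneda_sup_law Q X)"
proof -
  note PX = qcategory_PSh[OF X]
  have "qfunctor Q (PSh Q (PSh Q X)) (PSh Q (PSh Q X)) (yoneda (PSh Q X) \<circ> mult Q X)"
    by (rule qfunctor_comp[OF qcategory_PSh[OF PX] PX qcategory_PSh[OF PX]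
          qfunctor_mult[OF X] qfunctor_yoneda[OF PX]])
  then show ?thesis
    using yoneda_sup_law_eq[OF X] by (simp cong: qfunctor_cong)
qed

end

section \<open>The flat distributive law\<close>

theorem proposition5p1:
  fixes Q :: "('o, 'm) quantaloid_data"
    and X :: "('a, 'o, 'm) qcat"
  assumes "quantaloid Q"
    and "qcategory Q X"
  shows
    "qfunctor Q (PSh Q (PSh Q X)) (PSh Q (PSh Q X)) (yoneda_sup_law Q X) \<and>
     (\<forall>(Y :: ('b, 'o, 'm) qcat) f. qcategory Q Y \<longrightarrow> qfunctor Q X Y f \<longrightarrow>
        qfun_le Q (PSh Q (PSh Q X)) (PSh Q (PSh Q Y))
          (push Q (PSh Q X) (PSh Q Y) (push Q X Y f) \<circ> yoneda_sup_law Q X)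
          (yoneda_sup_law Q Y \<circ> push Q (PSh Q X) (PSh Q Y) (push Q X Y f))) \<and>
     (\<forall>\<sigma> \<in> elts (PSh Q X).
        yoneda (PSh Q X) \<sigma> = (yoneda_sup_law Q X \<circ> push Q X (PSh Q X) (yoneda X)) \<sigma>) \<and>
     qfun_le Q (PSh Q (PSh Q (PSh Q X))) (PSh Q (PSh Q X))
       (mult Q (PSh Q X) \<circ> push Q (PSh Q (PSh Q X)) (PSh Q (PSh Q X)) (yoneda_sup_law Q X)
          \<circ> yoneda_sup_law Q (PSh Q X))
       (yoneda_sup_law Q X \<circ> push Q (PSh Q (PSh Q X)) (PSh Q X) (mult Q X)) \<and>
     qfun_le Q (PSh Q X) (PSh Q (PSh Q X))
       (push Q X (PSh Q X) (yoneda X))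
       (yoneda_sup_law Q X \<circ> yoneda (PSh Q X)) \<and>
     qfun_le Q (PSh Q (PSh Q (PSh Q X))) (PSh Q (PSh Q X))
       (push Q (PSh Q (PSh Q X)) (PSh Q X) (mult Q X) \<circ> yoneda_sup_law Q (PSh Q X)
          \<circ> push Q (PSh Q (PSh Q X)) (PSh Q (PSh Q X)) (yoneda_sup_law Q X))
       (yoneda_sup_law Q X \<circ> mult Q (PSh Q X))"
proof -
  interpret quantaloid Q by fact
  note X = \<open>qcategory Q X\<close>
  note PX = qcategory_PSh[OF X]
  note PPX = qcategory_PSh[OF PX]
  let ?P = "PSh Q X"
  let ?PP = "PSh Q ?P"
  let ?PPP = "PSh Q ?PP"
  let ?L = "yoneda_sup_law Q X" and ?S = "mult Q X"
  note S = qfunctor_mult[OF X] and SP = qfunctor_mult[OF PX]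
    and L = qfunctor_yoneda_sup_law[OF X]
  note law = yoneda_sup_law_eq[OF X] and lawP = yoneda_sup_law_eq[OF PX]

  have natural: "push Q ?P (PSh Q Y) (push Q X Y f) (?L \<Sigma>)
      = yoneda_sup_law Q Y (push Q ?P (PSh Q Y) (push Q X Y f) \<Sigma>)"
    if Y: "qcategory Q Y" and f: "qfunctor Q X Y f" and \<Sigma>: "\<Sigma> \<in> elts ?PP"
    for Y :: "('b, 'o, 'm) qcat" and f \<Sigma>
  proof -
    note PY = qcategory_PSh[OF Y]
    note pf = qfunctor_push[OF X Y f]
    have "push Q X Y f (?S \<Sigma>) = colim ?P Y (push Q X Y f) \<Sigma>"
      unfolding push_eq_colim
      by (rule colim_mult[OF X Y qfunctor_comp[OF X Y PY f qfunctor_yoneda[OF Y]] \<Sigma>])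
    also have "\<dots> = mult Q Y (push Q ?P (PSh Q Y) (push Q X Y f) \<Sigma>)"
      by (rule mult_push[OF PX Y pf \<Sigma>, symmetric])
    finally show ?thesis
      using push_yoneda[OF PX PY pf qfunctor_elts[OF S \<Sigma>]]
        yoneda_sup_law_eq[OF Y qfunctor_elts[OF qfunctor_push[OF PX PY pf] \<Sigma>]] law[OF \<Sigma>]
      by simp
  qed

  have unit: "?S (push Q X ?P (yoneda X) \<sigma>) = \<sigma>" if "\<sigma> \<in> elts ?P" for \<sigma>
    using mult_push[OF X X qfunctor_yoneda[OF X] that] colim_of_yoneda[OF X that] by simp

  have push_y: "push Q X ?P (yoneda X) \<sigma> \<in> elts ?PP" if "\<sigma> \<in> elts ?P" for \<sigma>
    using qfunctor_elts[OF qfunctor_push[OF X PX qfunctor_yoneda[OF X]] that] .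

  have assoc: "?S (mult Q ?P \<Psi>) = ?S (push Q ?PP ?P ?S \<Psi>)" if "\<Psi> \<in> elts ?PPP" for \<Psi>
    using colim_mult[OF PX X qfunctor_id[OF PX] that] mult_push[OF PPX X S that]
    by (simp add: mult_eq_colim[OF X])

  have mult_law: "mult Q ?P (push Q ?PP ?PP ?L \<Psi>) = push Q ?PP ?P ?S \<Psi>"
    if "\<Psi> \<in> elts ?PPP" for \<Psi>
  proof -
    have "mult Q ?P (push Q ?PP ?PP ?L \<Psi>) = colim ?PP ?P ?L \<Psi>"
      by (rule mult_push[OF PPX PX L that])
    \<comment> \<open>The law and \<open>y \<cdot> s\<close> are known to agree only on presheaves, but a colimit depends on no
      other values of its diagram.\<close>
    also have "colim ?PP ?P ?L = colim ?PP ?P (yoneda ?P \<circ> ?S)"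
      by (rule colim_cong) (simp add: law)
    finally show ?thesis by (simp add: push_eq_colim)
  qed

  have law_mult: "mult Q ?P (push Q ?PP ?PP ?L (yoneda_sup_law Q ?P \<Psi>))
      = ?L (push Q ?PP ?P ?S \<Psi>)" if \<Psi>: "\<Psi> \<in> elts ?PPP" for \<Psi>
  proof -
    note M = qfunctor_elts[OF SP \<Psi>]
    have "push Q ?PP ?PP ?L (yoneda_sup_law Q ?P \<Psi>) = yoneda ?PP (?L (mult Q ?P \<Psi>))"
      using lawP[OF \<Psi>] push_yoneda[OF PPX PPX L M] by simp
    then have "mult Q ?P (push Q ?PP ?PP ?L (yoneda_sup_law Q ?P \<Psi>)) = ?L (mult Q ?P \<Psi>)"
      using mult_yoneda[OF PX qfunctor_elts[OF L M]] by simp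
    then show ?thesis
      using law[OF M] law[OF qfunctor_elts[OF qfunctor_push[OF PPX PX S] \<Psi>]] assoc[OF \<Psi>] by simp
  qed

  have law_unit: "elt_le Q ?PP (push Q X ?P (yoneda X) \<sigma>) (?L (yoneda ?P \<sigma>))"
    if \<sigma>: "\<sigma> \<in> elts ?P" for \<sigma>
    using below_yoneda_mult[OF X push_y[OF \<sigma>]] unit[OF \<sigma>] law[OF yoneda_elts[OF PX \<sigma>]]
      mult_yoneda[OF X \<sigma>] by simp

  have law_own_mult: "push Q ?PP ?P ?S (yoneda_sup_law Q ?P (push Q ?PP ?PP ?L \<Psi>)) = ?L (mult Q ?P \<Psi>)"
    if \<Psi>: "\<Psi> \<in> elts ?PPP" for \<Psi>
  proof -
    note N = qfunctor_elts[OF qfunctor_push[OF PPX PX S] \<Psi>]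
    have "yoneda_sup_law Q ?P (push Q ?PP ?PP ?L \<Psi>) = yoneda ?PP (push Q ?PP ?P ?S \<Psi>)"
      using lawP[OF qfunctor_elts[OF qfunctor_push[OF PPX PPX L] \<Psi>]] mult_law[OF \<Psi>] by simp
    then show ?thesis
      using push_yoneda[OF PPX PX S N] assoc[OF \<Psi>] law[OF qfunctor_elts[OF SP \<Psi>]] by simp
  qed

  show ?thesis
  proof (intro conjI allI impI ballI)
    show "qfunctor Q ?PP ?PP ?L" by (rule L)
  next
    fix Y :: "('b, 'o, 'm) qcat" and f
    assume Y: "qcategory Q Y" and f: "qfunctor Q X Y f"
    note PY = qcategory_PSh[OF Y]
    note pf = qfunctor_push[OF PX PY qfunctor_push[OF X Y f]]
    show "qfun_le Q ?PP (PSh Q (PSh Q Y))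
          (push Q ?P (PSh Q Y) (push Q X Y f) \<circ> ?L)
          (yoneda_sup_law Q Y \<circ> push Q ?P (PSh Q Y) (push Q X Y f))"
      using natural[OF Y f] elt_le_refl[OF qcategory_PSh[OF PY]] qfunctor_elts[OF L]
        qfunctor_elts[OF qfunctor_yoneda_sup_law[OF Y]] qfunctor_elts[OF pf]
      by (simp add: qfun_le_def)
  next
    fix \<sigma> assume "\<sigma> \<in> elts ?P"
    then show "yoneda ?P \<sigma> = (?L \<circ> push Q X ?P (yoneda X)) \<sigma>"
      using law[OF push_y] unit by simp
  next
    show "qfun_le Q ?PPP ?PP (mult Q ?P \<circ> push Q ?PP ?PP ?L \<circ> yoneda_sup_law Q ?P)
       (?L \<circ> push Q ?PP ?P ?S)"
      using law_mult elt_le_refl[OF PPX] qfunctor_elts[OF L]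
        qfunctor_elts[OF qfunctor_push[OF PPX PX S]]
      by (simp add: qfun_le_def)
  next
    show "qfun_le Q ?P ?PP (push Q X ?P (yoneda X)) (?L \<circ> yoneda ?P)"
      using law_unit by (simp add: qfun_le_def)
  next
    show "qfun_le Q ?PPP ?PP (push Q ?PP ?P ?S \<circ> yoneda_sup_law Q ?P \<circ> push Q ?PP ?PP ?L)
       (?L \<circ> mult Q ?P)"
      using law_own_mult elt_le_refl[OF PPX] qfunctor_elts[OF L] qfunctor_elts[OF SP]
      by (simp add: qfun_le_def)
  qed
qed

end
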